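(* Consider the setting with $n\ge2$ decision makers described in the context, with rounds $t\in\{1,\dots,T\}$. Suppose: (H1) for all $t$, $\mathcal{E}_t=\boldsymbol{\mathcal{E}}$ for some fixed matrix $\boldsymbol{\mathcal{E}}\in\mathbb{R}^{m\times d}$; (H2) for each decision maker $j$ and all $t$, $\gamma_{jt}=\gamma_j$ for some constant $\gamma_j\ge0$, and $Z_t$ is conditionally independent of $\{X_t,B_t\}$ given $\{W_{jt}\}_{j=1}^n$; and, for an arbitrary decision maker $i$, (M1) $\mathrm{cBP}_i(\{\boldsymbol{\theta}_{it},\boldsymbol{\theta}_t^{-i}\})=g_i(\boldsymbol{\theta}_{it})+h_i(\boldsymbol{\theta}_t^{-i})+c_i$ for some functions $g_i,h_i$ and constant $c_i$; (M2) $g_i(\boldsymbol{\theta}_{it})=\boldsymbol{\alpha}_i^\top\boldsymbol{\theta}_{it}+\beta_i$ for some vector $\boldsymbol{\alpha}_i\in\mathbb{R}^m$ and constant $\beta_i\in\mathbb{R}$; (M3) for all $\boldsymbol{\theta}_{it}$, $\|\boldsymbol{\theta}_{it}\|_2\le1$ (these are the admissible parameters). Then the optimal parameter vector for any decision maker $i$, i.e. the maximiser over admissible $\boldsymbol{\theta}_{it}$ of $\mathcal{Q}_i(\{\boldsymbol{\theta}_{it},\boldsymbol{\theta}_t^{-i}\})$ (the same for every value of $\boldsymbol{\theta}_t^{-i}$), takes the form $$\boldsymbol{\theta}_i^{\mathrm{AO}}=\frac{\boldsymbol{\alpha}_i+\gamma_i\boldsymbol{\mathcal{E}}\boldsymb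ol{\mathcal{E}}^\top\boldsymbol{\theta}_i^*}{\|\boldsymbol{\alpha}_i+\gamma_i\boldsymbol{\mathcal{E}}\boldsymbol{\mathcal{E}}^\top\boldsymbol{\theta}_i^*\|_2}.$$
   Context: Setting with $n$ decision makers (DMs). In round $t$ each DM $i$ publishes a parameter vector $\boldsymbol{\theta}_{it}\in\mathbb{R}^m$ and a selection rule $\boldsymbol{\delta}_{\boldsymbol{\theta}_{it}}:\mathbb{R}^m\to[0,1]$. Write $\boldsymbol{\theta}_t^{\mathrm{all}}=\{\boldsymbol{\theta}_{it},\boldsymbol{\theta}_t^{-i}\}=\{\boldsymbol{\theta}_{jt}\}_{j=1}^n$, where $\boldsymbol{\theta}_t^{-i}$ collects the parameters of all DMs other than $i$. An agent arrives with random baseline $B_t\in\mathbb{R}^m$, effort conversion matrix $\mathcal{E}_t\in\mathbb{R}^{m\times d}$ and real-valued unobserved noises $O_{it}$ (correlated with $B_t$). If the agent takes action $\mathbf{a}\in\mathbb{R}^d$, its covariates are $X_t=B_t+\mathcal{E}_t\mathbf{a}$ and its predicted outcomes are $\hat y_{it}=X_t^\top\boldsymbol{\theta}_{it}$. The agent chooses the action maximising $\sum_{i=1}^n\gamma_{it}\hat y_{it}-\frac12\|\mathbf{a}\|_2^2$ (with $\gamma_{it}\ge0$), i.e. $\mathbf{a}_t=\mathcal{E}_t^\top\sum_{j=1}^n\gamma_{jt}\boldsymbol{\theta}_{jt}$. Selection statuses $W_{it}\in\{0,1\}$ satisfy $W_{it}\sim\mathrm{Bernoulli}(\boldsymbol{\delta}_{\boldsymbol{\theta}_{it}}(X_t))$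 given $X_t$, and $Z_t\in\{0,1,\dots,n\}$ indicates the DM whose positive decision the agent complies with ($0$ if none). The potential outcome with DM $i$ is $Y_{it}=X_t^\top\boldsymbol{\theta}_i^*+O_{it}$, with $\boldsymbol{\theta}_i^*\in\mathbb{R}^m$ the fixed true causal parameter. The notation "$;\boldsymbol{\theta}_t^{\mathrm{all}}$" indicates the distribution induced by deploying $\boldsymbol{\theta}_t^{\mathrm{all}}$. The objective of DM $i$ is $$\mathcal{Q}_i(\boldsymbol{\theta}_t^{\mathrm{all}})=\mathbb{E}[Y_{it}\mid Z_t=i;\boldsymbol{\theta}_t^{\mathrm{all}}]=\mathrm{cBP}_i(\boldsymbol{\theta}_t^{\mathrm{all}})+\mathrm{cPI}_i(\boldsymbol{\theta}_t^{\mathrm{all}}),$$ where $\mathrm{cBP}_i(\boldsymbol{\theta}_t^{\mathrm{all}})=\mathbb{E}[B_t^\top\boldsymbol{\theta}_i^*+O_{it}\mid Z_t=i;\boldsymbol{\theta}_t^{\mathrm{all}}]$ and, when $\mathcal{E}_t=\boldsymbol{\mathcal{E}}$ and $\gamma_{jt}=\gamma_j$ are constant, $\mathrm{cPI}_i(\boldsymbol{\theta}_t^{\mathrm{all}})=\big(\sum_{j=1}^n\gamma_j\boldsymbol{\theta}_{jt}\big)^\top\boldsymbol{\mathcal{E}}\boldsymbol{\mathcal{E}}^\top\boldsymbol{\theta}_i^*$. *)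

theory Defs
  imports "HOL-Probability.Probability"
begin

text \<open>
  A model with decision makers indexed by the finite type \<^typ>\<open>'n\<close>, covariates in
  \<open>real^'m\<close> and actions in \<open>real^'d\<close>.  A profile \<open>\<theta> :: 'n \<Rightarrow> real^'m\<close> lists the parameters
  deployed by all decision makers.

  Distributions ``induced by deploying \<open>\<theta>\<close>'' are rendered by random variables that take the deployed
  profile as an argument and live on one probability space.  The agent's own characteristics
  (baseline, effort conversion matrix, weights, noises) do not take that argument, so deployment
  does not change their joint law; no independence between them is imposed.
\<close>

record ('w, 'n, 'm::finite, 'd::finite) dm_model =
  space_of :: "'w measure"
  baseline :: "nat \<Rightarrow> 'w \<Rightarrow> real^'m"
  effort :: "nat \<Rightarrow> 'w \<Rightarrow> real^'d^'m"
  noise :: "nat \<Rightarrow> 'n \<Rightarrow> 'w \<Rightarrow> real"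
  weight :: "nat \<Rightarrow> 'n \<Rightarrow> 'w \<Rightarrow> real"
  rule_of :: "'n \<Rightarrow> real^'m \<Rightarrow> real^'m \<Rightarrow> real"
  action :: "nat \<Rightarrow> ('n \<Rightarrow> real^'m) \<Rightarrow> 'w \<Rightarrow> real^'d"
  selected :: "nat \<Rightarrow> ('n \<Rightarrow> real^'m) \<Rightarrow> 'n \<Rightarrow> 'w \<Rightarrow> bool"
  complies :: "nat \<Rightarrow> ('n \<Rightarrow> real^'m) \<Rightarrow> 'w \<Rightarrow> 'n option"
    \<comment> \<open>\<open>None\<close> is the value \<open>0\<close> of \<open>Z\<close>: the agent complies with nobody\<close>
  causal :: "'n \<Rightarrow> real^'m"

definition agent_utility ::
  "('n::finite \<Rightarrow> real) \<Rightarrow> ('n \<Rightarrow> real^'m) \<Rightarrow> real^'m \<Rightarrow> real^'d^'m \<Rightarrow> real^'d \<Rightarrow> real" where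
  "agent_utility \<gamma> \<theta> b E a = (\<Sum>j\<in>UNIV. \<gamma> j * ((b + E *v a) \<bullet> \<theta> j)) - (norm a)\<^sup>2 / 2"

definition covariates ::
  "('w, 'n, 'm::finite, 'd::finite) dm_model \<Rightarrow> nat \<Rightarrow> ('n \<Rightarrow> real^'m) \<Rightarrow> 'w \<Rightarrow> real^'m" where
  "covariates S t \<theta> \<omega> = baseline S t \<omega> + effort S t \<omega> *v action S t \<theta> \<omega>"

definition outcome ::
  "('w, 'n, 'm::finite, 'd::finite) dm_model \<Rightarrow> 'n \<Rightarrow> nat \<Rightarrow> ('n \<Rightarrow> real^'m) \<Rightarrow> 'w \<Rightarrow> real" where
  "outcome S i t \<theta> \<omega> = covariates S t \<theta> \<omega> \<bullet> causal S i + noise S t i \<omega>"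

locale dm_setting = prob_space "space_of S"
  for S :: "('w, 'n::finite, 'm::finite, 'd::finite) dm_model" +
  fixes T :: nat
  assumes baseline_measurable:
      "t \<in> {1..T} \<Longrightarrow> baseline S t \<in> borel_measurable (space_of S)"
    and effort_measurable:
      "t \<in> {1..T} \<Longrightarrow> effort S t \<in> borel_measurable (space_of S)"
    and noise_measurable:
      "t \<in> {1..T} \<Longrightarrow> noise S t j \<in> borel_measurable (space_of S)"
    and weight_measurable:
      "t \<in> {1..T} \<Longrightarrow> weight S t j \<in> borel_measurable (space_of S)"
    and weight_nonneg:
      "t \<in> {1..T} \<Longrightarrow> \<omega> \<in> space (space_of S) \<Longrightarrow> 0 \<le> weight S t j \<omega>"
    and action_optimal:
      "t \<in> {1..T} \<Longrightarrow> \<omega> \<in> space (space_of S) \<Longrightarrow>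
       is_arg_max (agent_utility (\<lambda>j. weight S t j \<omega>) \<theta> (baseline S t \<omega>) (effort S t \<omega>))
         (\<lambda>_. True) (action S t \<theta> \<omega>)"
    and rule_measurable: "rule_of S j p \<in> borel_measurable borel"
    and rule_range: "rule_of S j p x \<in> {0..1}"
    and selected_measurable:
      "t \<in> {1..T} \<Longrightarrow> selected S t \<theta> j \<in> measurable (space_of S) (count_space UNIV)"
    and selected_bernoulli:
      "t \<in> {1..T} \<Longrightarrow>
       AE \<omega> in space_of S.
         real_cond_exp (space_of S) (vimage_algebra (space (space_of S)) (covariates S t \<theta>) borel)
           (indicator {\<omega> \<in> space (space_of S). selected S t \<theta> j \<omega>}) \<omega>
         = rule_of S j (\<theta> j) (covariates S t \<theta> \<omega>)"
    and complies_measurable: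
      "t \<in> {1..T} \<Longrightarrow> complies S t \<theta> \<in> measurable (space_of S) (count_space UNIV)"
    and complies_selected:
      "t \<in> {1..T} \<Longrightarrow> AE \<omega> in space_of S. complies S t \<theta> \<omega> = Some j \<longrightarrow> selected S t \<theta> j \<omega>"

text \<open>
  Conditional independence of \<open>Z\<close> and \<open>(X, B)\<close> given the finitely many values of \<open>W\<close>.  Where the
  conditioning event is null, both sides are \<open>0\<close>, so null values of \<open>W\<close> impose nothing.
\<close>

definition compliance_cond_indep ::
  "('w, 'n, 'm::finite, 'd::finite) dm_model \<Rightarrow> nat \<Rightarrow> ('n \<Rightarrow> real^'m) \<Rightarrow> bool" where
  "compliance_cond_indep S t \<theta> \<longleftrightarrow>
    (\<forall>w z. \<forall>A \<in> sets (borel :: ((real^'m) \<times> (real^'m)) measure).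
      \<P>(\<omega> in space_of S. complies S t \<theta> \<omega> = z \<and> (covariates S t \<theta> \<omega>, baseline S t \<omega>) \<in> A
          \<bar> (\<lambda>j. selected S t \<theta> j \<omega>) = w)
      = \<P>(\<omega> in space_of S. complies S t \<theta> \<omega> = z \<bar> (\<lambda>j. selected S t \<theta> j \<omega>) = w)
        * \<P>(\<omega> in space_of S. (covariates S t \<theta> \<omega>, baseline S t \<omega>) \<in> A \<bar> (\<lambda>j. selected S t \<theta> j \<omega>) = w))"

definition compliers ::
  "('w, 'n, 'm::finite, 'd::finite) dm_model \<Rightarrow> 'n \<Rightarrow> nat \<Rightarrow> ('n \<Rightarrow> real^'m) \<Rightarrow> 'w set" where
  "compliers S i t \<theta> = {\<omega> \<in> space (space_of S). complies S t \<theta> \<omega> = Some i}"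

definition cond_mean :: "'w measure \<Rightarrow> 'w set \<Rightarrow> ('w \<Rightarrow> real) \<Rightarrow> real" where
  "cond_mean M A f = (LINT \<omega>:A|M. f \<omega>) / measure M A"

definition Q ::
  "('w, 'n, 'm::finite, 'd::finite) dm_model \<Rightarrow> 'n \<Rightarrow> nat \<Rightarrow> ('n \<Rightarrow> real^'m) \<Rightarrow> real" where
  "Q S i t \<theta> = cond_mean (space_of S) (compliers S i t \<theta>) (outcome S i t \<theta>)"

definition baseline_outcome ::
  "('w, 'n, 'm::finite, 'd::finite) dm_model \<Rightarrow> 'n \<Rightarrow> nat \<Rightarrow> 'w \<Rightarrow> real" where
  "baseline_outcome S i t \<omega> = baseline S t \<omega> \<bullet> causal S i + noise S t i \<omega>"

definition cBP ::
  "('w, 'n, 'm::finite, 'd::finite) dm_model \<Rightarrow> 'n \<Rightarrow> nat \<Rightarrow> ('n \<Rightarrow> real^'m) \<Rightarrow> real" where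
  "cBP S i t \<theta> = cond_mean (space_of S) (compliers S i t \<theta>) (baseline_outcome S i t)"

text \<open>\<^const>\<open>cond_mean\<close> is a genuine conditional expectation only when the following holds.\<close>

definition cBP_exists ::
  "('w, 'n, 'm::finite, 'd::finite) dm_model \<Rightarrow> 'n \<Rightarrow> nat \<Rightarrow> ('n \<Rightarrow> real^'m) \<Rightarrow> bool" where
  "cBP_exists S i t \<theta> \<longleftrightarrow>
    measure (space_of S) (compliers S i t \<theta>) > 0 \<and>
    set_integrable (space_of S) (compliers S i t \<theta>) (baseline_outcome S i t)"

definition admissible :: "('n \<Rightarrow> real^'m::finite) \<Rightarrow> bool" where
  "admissible \<theta> \<longleftrightarrow> (\<forall>j. norm (\<theta> j) \<le> 1)"

text \<open>The parameters of all decision makers other than \<open>i\<close>.\<close>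

definition others :: "'n \<Rightarrow> ('n \<Rightarrow> real^'m::finite) \<Rightarrow> 'n \<Rightarrow> real^'m" where
  "others i \<theta> = restrict \<theta> (- {i})"

end

theory Submission
  imports Defs
begin

text \<open>
  The best response to the published parameters is \<open>a = E\<^sup>T (\<Sum>\<gamma>\<^sub>j \<theta>\<^sub>j)\<close>, which no longer depends on the
  agent once \<open>E\<close> and the \<open>\<gamma>\<^sub>j\<close> are constant.  The improvement part of \<open>Q\<^sub>i\<close> is therefore the constant
  \<open>(\<Sum>\<gamma>\<^sub>j \<theta>\<^sub>j)\<^sup>T E E\<^sup>T \<theta>\<^sub>i\<^sup>*\<close>, which conditioning on compliance leaves unchanged.  Together with (M1) and (M2) this
  makes \<open>Q\<^sub>i\<close> affine in \<open>\<theta>\<^sub>i\<close> with gradient \<open>\<alpha>\<^sub>i + \<gamma>\<^sub>i E E\<^sup>T \<theta>\<^sub>i\<^sup>*\<close>, and Cauchy--Schwarz with its equality case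
  gives the maximiser on the unit ball.
\<close>

lemma inner_matrix_vector_transpose:
  fixes A :: "real^'d^'m" and x :: "real^'d" and y :: "real^'m"
  shows "(A *v x) \<bullet> y = x \<bullet> (transpose A *v y)"
  using dot_lmul_matrix[of y A x] by (simp add: inner_commute)

text \<open>Completing the square: comparing the maximiser with the single competitor
  \<open>u\<close> already rearranges to \<open>(norm (a - u))\<^sup>2 \<le> 0\<close>.\<close>

lemma is_arg_max_inner_minus_half_norm:
  fixes u :: "'a::real_inner"
  assumes "is_arg_max (\<lambda>a. k + a \<bullet> u - (norm a)\<^sup>2 / 2) (\<lambda>_. True) a"
  shows "a = u"
proof -
  have "k + u \<bullet> u - (norm u)\<^sup>2 / 2 \<le> k + a \<bullet> u - (norm a)\<^sup>2 / 2"
    using assms by (auto simp: is_arg_max_def not_less)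
  then have "(norm (a - u))\<^sup>2 \<le> 0"
    by (simp add: power2_norm_eq_inner inner_diff_left inner_diff_right inner_commute)
  then show ?thesis by simp
qed

text \<open>Cauchy-Schwarz bounds the linear part by \<open>norm v\<close>, and its equality case
  gives uniqueness. The formula for \<open>f\<close> is required on the ball only, which is where
  (M1) and (M2) will provide it.\<close>

lemma is_arg_max_affine_unit_ball:
  fixes v :: "'a::real_inner"
  assumes "v \<noteq> 0" and f: "\<And>y. norm y \<le> 1 \<Longrightarrow> f y = k + v \<bullet> y"
  shows "is_arg_max f (\<lambda>y. norm y \<le> 1) x \<longleftrightarrow> x = (1 / norm v) *\<^sub>R v"
proof -
  define e where "e = (1 / norm v) *\<^sub>R v"
  have e: "norm e = 1" "v \<bullet> e = norm v"
    using \<open>v \<noteq> 0\<close> by (simp_all add: e_def norm_eq_sqrt_inner power2_eq_square real_div_sqrt)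
  have le: "v \<bullet> y \<le> norm v" if "norm y \<le> 1" for y
    using norm_cauchy_schwarz[of v y] mult_left_mono[OF that norm_ge_zero[of v]] by simp
  \<comment> \<open>Equality case: attaining the bound means \<open>e \<bullet> y \<ge> 1\<close>,
    and expanding the squared distance from \<open>y\<close> to \<open>e\<close> then leaves at most
    1 + 1 - 2.\<close>
  have "y = e" if "norm y \<le> 1" "norm v \<le> v \<bullet> y" for y
  proof -
    have "e \<bullet> y \<ge> 1"
      using that \<open>v \<noteq> 0\<close> by (simp add: e_def)
    moreover have "(norm y)\<^sup>2 \<le> 1"
      using that by (simp add: power_le_one)
    moreover have "(norm (y - e))\<^sup>2 = (norm y)\<^sup>2 + (norm e)\<^sup>2 - 2 * (e \<bullet> y)"
      by (simp add: power2_norm_eq_inner inner_diff_left inner_diff_right inner_commute)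
    ultimately have "(norm (y - e))\<^sup>2 \<le> 0"
      using e by simp
    then show ?thesis by simp
  qed
  then have "is_arg_max f (\<lambda>y. norm y \<le> 1) x \<longleftrightarrow> x = e"
    unfolding is_arg_max_def using e le f by (smt (verit))
  then show ?thesis by (simp add: e_def)
qed

lemma cond_mean_AE_eq_add_const:
  assumes A: "measure M A > 0"
    and int: "set_integrable M A f"
    and meas: "h \<in> borel_measurable M" "A \<in> sets M"
    and AE: "AE \<omega> in M. h \<omega> = f \<omega> + c"
  shows "cond_mean M A h = cond_mean M A f + c"
proof -
  \<comment> \<open>\<open>M\<close> is an arbitrary measure here. Since \<open>measure\<close>
    takes the value 0 on sets of infinite measure, positivity forces finiteness, so constants are
    integrable over \<open>A\<close>.\<close>
  have fin: "emeasure M A < \<infinity>"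
    using A by (metis emeasure_eq_measure2 ennreal_less_top enn2real_top infinity_ennreal_def
        less_irrefl less_top measure_def)
  then have c: "set_integrable M A (\<lambda>_. c)"
    using meas by (simp add: set_integrable_def)
  have fc: "set_integrable M A (\<lambda>\<omega>. f \<omega> + c)"
    using int c by (rule set_integral_add)
  have "(LINT \<omega>:A|M. h \<omega>) = (LINT \<omega>:A|M. f \<omega> + c)"
    unfolding set_lebesgue_integral_def
  proof (rule integral_cong_AE)
    show "(\<lambda>\<omega>. indicat_real A \<omega> *\<^sub>R h \<omega>) \<in> borel_measurable M"
      using meas by measurable
    show "(\<lambda>\<omega>. indicat_real A \<omega> *\<^sub>R (f \<omega> + c)) \<in> borel_measurable M"
      using fc by (auto simp: set_integrable_def)
    show "AE \<omega> in M. indicat_real A \<omega> *\<^sub>R h \<omega> = indicat_real A \<omega> *\<^sub>R (f \<omega> + c)"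
      using AE by eventually_elim simp
  qed
  also have "\<dots> = (LINT \<omega>:A|M. f \<omega>) + c * measure M A"
    using set_integral_add(2)[OF int c] meas by (simp add: set_lebesgue_integral_def)
  finally show ?thesis
    using A by (simp add: cond_mean_def field_simps)
qed

context dm_setting
begin

text \<open>With \<open>s\<close> the weighted sum of the parameters and E the effort matrix, the
  utility is a constant plus \<open>a \<bullet> (transpose E *v s)\<close> minus half the squared
  norm of \<open>a\<close>. This holds pointwise, with effort and weights still random.\<close>

lemma action_eq:
  assumes "t \<in> {1..T}" "\<omega> \<in> space (space_of S)"
  shows "action S t \<theta> \<omega> = transpose (effort S t \<omega>) *v (\<Sum>j\<in>UNIV. weight S t j \<omega> *\<^sub>R \<theta> j)"
proof (rule is_arg_max_inner_minus_half_norm)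
  let ?s = "\<Sum>j\<in>UNIV. weight S t j \<omega> *\<^sub>R \<theta> j"
  have "agent_utility (\<lambda>j. weight S t j \<omega>) \<theta> (baseline S t \<omega>) (effort S t \<omega>) a
      = baseline S t \<omega> \<bullet> ?s + a \<bullet> (transpose (effort S t \<omega>) *v ?s) - (norm a)\<^sup>2 / 2" for a
    unfolding agent_utility_def inner_matrix_vector_transpose[symmetric]
    by (simp add: inner_sum_right inner_add_left distrib_left sum.distrib)
  then show "is_arg_max (\<lambda>a. baseline S t \<omega> \<bullet> ?s
        + a \<bullet> (transpose (effort S t \<omega>) *v ?s) - (norm a)\<^sup>2 / 2) (\<lambda>_. True) (action S t \<theta> \<omega>)"
    using action_optimal[OF assms, of \<theta>] by (simp add: is_arg_max_def)
qed

lemma outcome_eq: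
  assumes "t \<in> {1..T}" "\<omega> \<in> space (space_of S)"
  shows "outcome S i t \<theta> \<omega> = baseline_outcome S i t \<omega>
    + (transpose (effort S t \<omega>) *v (\<Sum>j\<in>UNIV. weight S t j \<omega> *\<^sub>R \<theta> j))
      \<bullet> (transpose (effort S t \<omega>) *v causal S i)"
  by (simp add: outcome_def covariates_def baseline_outcome_def action_eq[OF assms]
      inner_add_left inner_matrix_vector_transpose)

text \<open>Measurability of \<open>action\<close> is not among the assumptions of the setting; it
  enters through the closed form of the best response.\<close>

lemma outcome_measurable:
  assumes t: "t \<in> {1..T}"
  shows "outcome S i t \<theta> \<in> borel_measurable (space_of S)"
proof -
  note [measurable] = baseline_measurable[OF t] effort_measurable[OF t]
    noise_measurable[OF t] weight_measurable[OF t]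
  have [measurable]: "(\<lambda>\<omega>. transpose (effort S t \<omega>) *v x) \<in> borel_measurable (space_of S)" for x
  proof -
    have "linear (\<lambda>E :: real^'d^'m. transpose E *v x)"
      by (rule linearI) (simp_all add: vec_eq_iff matrix_vector_mult_def transpose_def
          distrib_right sum.distrib sum_distrib_left mult.assoc)
    then have "(\<lambda>E :: real^'d^'m. transpose E *v x) \<in> borel_measurable borel"
      by (intro borel_measurable_continuous_onI linear_continuous_on)
        (simp add: linear_conv_bounded_linear)
    from measurable_compose[OF effort_measurable[OF t] this] show ?thesis .
  qed
  \<comment> \<open>Expanding the sum over \<open>j\<close> pulls the random weights out, so the
    random matrix is applied only to fixed vectors.\<close>
  have "outcome S i t \<theta> \<in> borel_measurable (space_of S) \<longleftrightarrow>
    (\<lambda>\<omega>. baseline S t \<omega> \<bullet> causal S i + noise S t i \<omega>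
      + (\<Sum>j\<in>UNIV. weight S t j \<omega> * ((transpose (effort S t \<omega>) *v \<theta> j)
        \<bullet> (transpose (effort S t \<omega>) *v causal S i)))) \<in> borel_measurable (space_of S)"
    by (rule measurable_cong)
      (simp add: outcome_eq[OF t] baseline_outcome_def matrix_vector_mult_scaleR inner_sum_left
        linear_sum[OF matrix_vector_mul_linear] o_def)
  then show ?thesis by (simp del: transpose_matrix_vector)
qed

lemma Q_eq_cBP_add_improvement:
  assumes t: "t \<in> {1..T}"
    and effort: "AE \<omega> in space_of S. effort S t \<omega> = EE"
    and weight: "\<And>j. AE \<omega> in space_of S. weight S t j \<omega> = \<gamma> j"
    and ex: "cBP_exists S i t \<theta>"
  shows "Q S i t \<theta> = cBP S i t \<theta>
    + (\<Sum>j\<in>UNIV. \<gamma> j *\<^sub>R \<theta> j) \<bullet> ((EE ** transpose EE) *v causal S i)"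
  unfolding Q_def cBP_def
proof (rule cond_mean_AE_eq_add_const)
  show "compliers S i t \<theta> \<in> sets (space_of S)"
    using measurable_sets[OF complies_measurable[OF t], of "{Some i}" \<theta>]
    by (simp add: compliers_def vimage_def Int_def conj_commute)
  have inner_eq: "(transpose EE *v s) \<bullet> (transpose EE *v p) = s \<bullet> ((EE ** transpose EE) *v p)" for s p
    by (metis inner_commute inner_matrix_vector_transpose matrix_vector_mul_assoc)
  \<comment> \<open>There are finitely many decision makers, so one null set serves all
    \<open>j\<close>.\<close>
  have "AE \<omega> in space_of S. \<forall>j. weight S t j \<omega> = \<gamma> j"
    using weight by (simp add: AE_all_countable)
  with effort AE_space
  show "AE \<omega> in space_of S. outcome S i t \<theta> \<omega> = baseline_outcome S i t \<omega>
      + (\<Sum>j\<in>UNIV. \<gamma> j *\<^sub>R \<theta> j) \<bullet> ((EE ** transpose EE) *v causal S i)"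
  proof eventually_elim
    case (elim \<omega>)
    then show ?case
      by (simp add: outcome_eq[OF t] inner_eq del: transpose_matrix_vector)
  qed
qed (use ex outcome_measurable[OF t] in \<open>auto simp: cBP_exists_def\<close>)

end

theorem theorem3p5:
  fixes S :: "('w, 'n::finite, 'm::finite, 'd::finite) dm_model"
    and T :: nat and i :: 'n
    and EE :: "real^'d^'m" and \<gamma> :: "'n \<Rightarrow> real"
    and g :: "real^'m \<Rightarrow> real" and h :: "('n \<Rightarrow> real^'m) \<Rightarrow> real" and c :: real
    and \<alpha> :: "real^'m" and \<beta> :: real
  defines "v \<equiv> \<alpha> + \<gamma> i *\<^sub>R ((EE ** transpose EE) *v causal S i)"
  assumes n: "CARD('n) \<ge> 2"
    and setting: "dm_setting S T"
    and H1: "\<And>t. t \<in> {1..T} \<Longrightarrow> AE \<omega> in space_of S. effort S t \<omega> = EE"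
    and H2_nonneg: "\<And>j. \<gamma> j \<ge> 0"
    and H2_weight: "\<And>t j. t \<in> {1..T} \<Longrightarrow> AE \<omega> in space_of S. weight S t j \<omega> = \<gamma> j"
    and H2_indep: "\<And>t \<theta>. t \<in> {1..T} \<Longrightarrow> admissible \<theta> \<Longrightarrow> compliance_cond_indep S t \<theta>"
    and exists: "\<And>t \<theta>. t \<in> {1..T} \<Longrightarrow> admissible \<theta> \<Longrightarrow> cBP_exists S i t \<theta>"
    and M1: "\<And>t \<theta>. t \<in> {1..T} \<Longrightarrow> admissible \<theta> \<Longrightarrow>
               cBP S i t \<theta> = g (\<theta> i) + h (others i \<theta>) + c"
    and M2: "\<And>x. norm x \<le> 1 \<Longrightarrow> g x = \<alpha> \<bullet> x + \<beta>"
    and nonzero: "v \<noteq> 0"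
  shows "\<forall>t \<in> {1..T}. \<forall>\<theta>. admissible \<theta> \<longrightarrow>
           (\<forall>x. is_arg_max (\<lambda>y. Q S i t (\<theta>(i := y))) (\<lambda>y. norm y \<le> 1) x
                  \<longleftrightarrow> x = (1 / norm v) *\<^sub>R v)"
proof (intro ballI allI impI)
  fix t x and \<theta> :: "'n \<Rightarrow> real^'m"
  assume t: "t \<in> {1..T}" and \<theta>: "admissible \<theta>"
  interpret dm_setting S T by (rule setting)
  let ?p = "(EE ** transpose EE) *v causal S i"
  \<comment> \<open>Everything in the objective that is unaffected by the parameter of
    \<open>i\<close>: it depends on the other parameters only, so it shifts the maximum without
    moving the maximiser.\<close>
  define k where
    "k = \<beta> + h (others i \<theta>) + c + (\<Sum>j\<in>-{i}. \<gamma> j *\<^sub>R \<theta> j) \<bullet> ?p"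
  show "is_arg_max (\<lambda>y. Q S i t (\<theta>(i := y))) (\<lambda>y. norm y \<le> 1) x \<longleftrightarrow> x = (1 / norm v) *\<^sub>R v"
  proof (rule is_arg_max_affine_unit_ball[OF nonzero])
    fix y :: "real^'m"
    assume y: "norm y \<le> 1"
    let ?\<theta> = "\<theta>(i := y)"
    \<comment> \<open>Every competitor in the ball gives an admissible profile, so (M1) and the
      existence of \<open>cBP\<close> apply to it.\<close>
    have adm: "admissible ?\<theta>"
      using \<theta> y by (simp add: admissible_def)
    have oth: "others i ?\<theta> = others i \<theta>"
      by (auto simp: others_def)
    have "(\<Sum>j\<in>UNIV. \<gamma> j *\<^sub>R ?\<theta> j) = \<gamma> i *\<^sub>R y + (\<Sum>j\<in>-{i}. \<gamma> j *\<^sub>R \<theta> j)"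
      by (simp add: sum.remove[of UNIV i] Compl_eq_Diff_UNIV)
    moreover have "Q S i t ?\<theta> = cBP S i t ?\<theta> + (\<Sum>j\<in>UNIV. \<gamma> j *\<^sub>R ?\<theta> j) \<bullet> ?p"
      using t H1 H2_weight exists adm by (intro Q_eq_cBP_add_improvement) auto
    ultimately show "Q S i t ?\<theta> = k + v \<bullet> y"
      using M1[OF t adm] M2[OF y] oth
      by (simp add: k_def v_def inner_add_left inner_commute[of y])
  qed
qed

end
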